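(* For every integer $n\ge 1$, \[|J(P_n)|=2^{n-1}\qquad\text{and}\qquad F(J(P_n),q)=\prod_{j=1}^{n-1}(1+q^j).\]
   Context: For an integer $n\ge 1$, let $P_n$ be the set of pairs $(c_1,c_2)$ of nonnegative integers with $c_1+c_2\le n-2$. Associate to the colors red, green, blue the vectors $r=(1,0)$, $g=(0,1)$, $b=(-1,1)$. The poset $P_n$ has as order relation the reflexive–transitive closure of the relations $u<u+v$ for all $u,u+v\in P_n$ and $v\in\{r,g,b\}$. For a finite poset $P$, $J(P)$ denotes the set (lattice) of order ideals (down-closed subsets) of $P$, and its rank generating function is $F(J(P),q)=\sum_{I\in J(P)}q^{|I|}$. *)

theory Defs
  imports Main "HOL-Library.Product_Plus" "HOL-Computational_Algebra.Polynomial"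
begin

definition red :: "int \<times> int" where "red = (1, 0)"
definition green :: "int \<times> int" where "green = (0, 1)"
definition blue :: "int \<times> int" where "blue = (-1, 1)"

text \<open>Integer coordinates, so that the bound is not truncated: for \<open>n \<le> 1\<close> the set is empty.\<close>

definition P :: "nat \<Rightarrow> (int \<times> int) set" where
  "P n = {(c1, c2). 0 \<le> c1 \<and> 0 \<le> c2 \<and> c1 + c2 \<le> int n - 2}"

definition P_step :: "nat \<Rightarrow> ((int \<times> int) \<times> (int \<times> int)) set" where
  "P_step n = {(u, w). u \<in> P n \<and> w \<in> P n \<and> (\<exists>v \<in> {red, green, blue}. w = u + v)}"

text \<open>The library closure is reflexive on the whole type; intersecting with the carrier turns it
  into the reflexive-transitive closure on \<open>P n\<close> (the steps never leave \<open>P n\<close>).\<close>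

definition P_le :: "nat \<Rightarrow> ((int \<times> int) \<times> (int \<times> int)) set" where
  "P_le n = (P_step n)\<^sup>* \<inter> (P n \<times> P n)"

definition order_ideals :: "'a set \<Rightarrow> ('a \<times> 'a) set \<Rightarrow> 'a set set" where
  "order_ideals A r = {I. I \<subseteq> A \<and> (\<forall>x \<in> I. \<forall>y \<in> A. (y, x) \<in> r \<longrightarrow> y \<in> I)}"

text \<open>The rank generating function as a polynomial in the indeterminate \<open>q\<close>: \<open>monom 1 k\<close> is \<open>q ^ k\<close>.
  Only meaningful for finite \<open>A\<close>.\<close>

definition rank_gf :: "'a set \<Rightarrow> ('a \<times> 'a) set \<Rightarrow> int poly" where
  "rank_gf A r = (\<Sum>I \<in> order_ideals A r. monom 1 (card I))"

lemma finite_P: "finite (P n)"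
proof (rule finite_subset)
  show "P n \<subseteq> {0..int n} \<times> {0..int n}" by (auto simp: P_def)
qed simp

lemma partial_order_on_P: "partial_order_on (P n) (P_le n)"
proof -
  have mono: "fst u + 2 * snd u < fst w + 2 * snd w" if "(u, w) \<in> P_step n" for u w
    using that by (auto simp: P_step_def red_def green_def blue_def)
  have weight: "u = w \<or> fst u + 2 * snd u < fst w + 2 * snd w" if "(u, w) \<in> (P_step n)\<^sup>*" for u w
    using that
  proof (induction rule: rtrancl_induct)
    case (step y z)
    then show ?case using mono[of y z] by auto
  qed simp
  have "antisym (P_le n)"
  proof (rule antisymI)
    fix u w assume "(u, w) \<in> P_le n" "(w, u) \<in> P_le n"
    then show "u = w" using weight[of u w] weight[of w u] by (auto simp: P_le_def)
  qed
  moreover have "trans (P_le n)"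
    by (auto simp: P_le_def intro!: transI)
  ultimately show ?thesis
    by (auto simp: partial_order_on_def preorder_on_def refl_on_def P_le_def)
qed

end

(* An order ideal of P_(n+1) either misses the point (n-1, 0), and then misses the whole
   antidiagonal c1 + c2 = n - 1 above it and is an ideal of P_n; or it contains that point, and then
   contains the whole bottom row (n points) and is an ideal of P_n, moved up by one, on top of that
   row. Hence F(J(P_(n+1)), q) = (1 + q^n) F(J(P_n), q), and q = 1 gives the cardinality. *)

theory Submission
  imports Defs
begin

abbreviation J :: "nat \<Rightarrow> (int \<times> int) set set" where
  "J n \<equiv> order_ideals (P n) (P_le n)"

lemma order_idealD:
  assumes "I \<in> J n" and "(u, w) \<in> P_step n" and "w \<in> I"
  shows "u \<in> I"
proof -
  from assms(2) have "(u, w) \<in> P_le n" "u \<in> P n"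
    by (auto simp: P_le_def P_step_def)
  with assms(1,3) show ?thesis by (auto simp: order_ideals_def)
qed

text \<open>Closure under single steps suffices: a relation in the closure is a chain of steps, and
  membership passes down it one step at a time.\<close>

lemma order_idealI:
  assumes "I \<subseteq> P n" and "\<And>u w. (u, w) \<in> P_step n \<Longrightarrow> w \<in> I \<Longrightarrow> u \<in> I"
  shows "I \<in> J n"
proof -
  have "u \<in> I" if "(u, w) \<in> (P_step n)\<^sup>*" "w \<in> I" for u w
    using that by (induction rule: converse_rtrancl_induct) (auto dest: assms(2))
  then show ?thesis using assms(1) by (auto simp: order_ideals_def P_le_def)
qed

lemma P_step_iff:
  "(u, w) \<in> P_step n \<longleftrightarrow> u \<in> P n \<and> w \<in> P n
    \<and> (u = (fst w - 1, snd w) \<or> u = (fst w, snd w - 1) \<or> u = (fst w + 1, snd w - 1))"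
  by (cases u; cases w) (auto simp: P_step_def red_def green_def blue_def)

text \<open>The working form of ideals: each guard says exactly when that lower neighbour of a point
  of \<open>P n\<close> is again in \<open>P n\<close>. The blue neighbour
  \<open>(a + 1, b - 1)\<close> keeps the coordinate sum, so it cannot break the upper bound. Since
  \<open>n\<close> now occurs only in \<open>I \<subseteq> P n\<close>, ideals for \<open>n\<close>
  and \<open>Suc n\<close> are easily compared.\<close>

lemma order_ideals_P_iff:
  "I \<in> J n \<longleftrightarrow> I \<subseteq> P n \<and> (\<forall>a b. (a, b) \<in> I \<longrightarrow>
     (1 \<le> a \<longrightarrow> (a - 1, b) \<in> I) \<and> (1 \<le> b \<longrightarrow> (a, b - 1) \<in> I \<and> (a + 1, b - 1) \<in> I))"
  (is "_ \<longleftrightarrow> ?R")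
proof
  assume I: "I \<in> J n"
  then have sub: "I \<subseteq> P n" by (simp add: order_ideals_def)
  have "(1 \<le> a \<longrightarrow> (a - 1, b) \<in> I) \<and> (1 \<le> b \<longrightarrow> (a, b - 1) \<in> I \<and> (a + 1, b - 1) \<in> I)"
    if ab: "(a, b) \<in> I" for a b
  proof -
    have *: "u \<in> P n \<Longrightarrow> u = (a - 1, b) \<or> u = (a, b - 1) \<or> u = (a + 1, b - 1) \<Longrightarrow> u \<in> I" for u
      using order_idealD[OF I _ ab, of u] sub ab by (auto simp: P_step_iff)
    from sub ab have "(a, b) \<in> P n" by blast
    then show ?thesis by (auto simp: P_def intro!: *)
  qed
  with sub show ?R by blast
next
  assume R: ?R
  show "I \<in> J n"
  proof (rule order_idealI)
    fix u w assume "(u, w) \<in> P_step n" "w \<in> I"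
    with R show "u \<in> I"
      by (cases w) (auto simp: P_step_iff P_def)
  qed (use R in blast)
qed

lemma order_ideal_subset: "I \<in> J n \<Longrightarrow> I \<subseteq> P n"
  by (simp add: order_ideals_def)

lemma order_ideal_bounds:
  assumes "I \<in> J n" and "(a, b) \<in> I"
  shows "0 \<le> a" "0 \<le> b" "a + b \<le> int n - 2"
  using subsetD[OF order_ideal_subset[OF assms(1)] assms(2)] by (simp_all add: P_def)

lemma order_ideal_closed:
  assumes "I \<in> J n" and "(a, b) \<in> I"
  shows "1 \<le> a \<Longrightarrow> (a - 1, b) \<in> I"
    and "1 \<le> b \<Longrightarrow> (a, b - 1) \<in> I"
    and "1 \<le> b \<Longrightarrow> (a + 1, b - 1) \<in> I"
  using assms by (simp_all add: order_ideals_P_iff)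

lemma P_mono: "m \<le> n \<Longrightarrow> P m \<subseteq> P n"
  by (auto simp: P_def)

text \<open>The points at height 0 of \<open>P (Suc n)\<close>, not of \<open>P n\<close>: there the
  bound on the first coordinate is n - 1.\<close>

definition bottom_row :: "nat \<Rightarrow> (int \<times> int) set" where
  "bottom_row n = {0..<int n} \<times> {0}"

definition stack :: "nat \<Rightarrow> (int \<times> int) set \<Rightarrow> (int \<times> int) set" where
  "stack n I = bottom_row n \<union> (+) (0, 1) ` I"

lemma mem_stack_iff: "(a, b) \<in> stack n I \<longleftrightarrow> (b = 0 \<and> 0 \<le> a \<and> a < int n) \<or> (a, b - 1) \<in> I"
proof -
  have "(a, b) \<in> (+) (0, 1) ` I \<longleftrightarrow> (a, b - 1) \<in> I"
    by (force simp: image_iff)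
  then show ?thesis by (auto simp: stack_def bottom_row_def)
qed

lemma row_shift_disjoint:
  assumes "I \<subseteq> P n"
  shows "bottom_row m \<inter> (+) (0, 1) ` I = {}"
  using assms by (force simp: bottom_row_def P_def)

lemma card_stack:
  assumes "I \<subseteq> P n"
  shows "card (stack m I) = m + card I"
proof -
  have "finite I" using assms finite_P by (rule finite_subset)
  then have "card (stack m I) = card (bottom_row m) + card ((+) (0, 1) ` I)"
    unfolding stack_def using row_shift_disjoint[OF assms]
    by (intro card_Un_disjoint) (auto simp: bottom_row_def)
  also have "card ((+) (0, 1) ` I) = card I"
    by (simp add: card_image)
  finally show ?thesis by (simp add: bottom_row_def)
qed

text \<open>Subsets of \<open>P n\<close> have heights at least 0, so their shifts avoid the row;
  deleting the row recovers the shift, and translation is injective.\<close>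

lemma inj_on_stack: "inj_on (stack m) (Pow (P n))"
proof (rule inj_onI)
  fix I K assume *: "I \<in> Pow (P n)" "K \<in> Pow (P n)" "stack m I = stack m K"
  have "(+) (0, 1) ` L = stack m L - bottom_row m" if "L \<in> Pow (P n)" for L
    using row_shift_disjoint[of L n m] that by (auto simp: stack_def)
  with * have "(+) (0, 1) ` I = (+) (0, 1) ` K" by simp
  then show "I = K" by (simp add: inj_image_eq_iff)
qed

lemma order_ideals_subset_Pow: "J n \<subseteq> Pow (P n)"
  using order_ideal_subset by blast

lemma finite_order_ideals: "finite (J n)"
  using order_ideals_subset_Pow finite_P by (rule finite_subset[OF _ finite_Pow_iff[THEN iffD2]])

lemma stack_in_order_ideals:
  assumes "I \<in> J n"
  shows "stack n I \<in> J (Suc n)"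
  unfolding order_ideals_P_iff
proof (intro conjI allI impI subrelI)
  note bounds = order_ideal_bounds[OF assms] and closed = order_ideal_closed[OF assms]
  fix a b assume ab: "(a, b) \<in> stack n I"
  then show "(a, b) \<in> P (Suc n)"
    using bounds[of a "b - 1"] by (auto simp: mem_stack_iff P_def)
  show "(a - 1, b) \<in> stack n I" if "1 \<le> a"
    using ab that closed(1)[of a "b - 1"] by (auto simp: mem_stack_iff)
  have low: "(a, b - 1) \<in> I" if "1 \<le> b"
    using ab that by (simp add: mem_stack_iff)
  \<comment> \<open>Height 1 is the case where the neighbours fall into the row rather than into the
    shifted ideal. There \<open>(a, 0)\<close> is in \<open>I\<close>, so a \<le> n - 2, and both a
    and a + 1 lie within the row of length n.\<close>
  show "(a, b - 1) \<in> stack n I" if "1 \<le> b"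
    using that bounds[OF low[OF that]] closed(2)[OF low[OF that]]
    by (cases "b = 1") (simp_all add: mem_stack_iff)
  show "(a + 1, b - 1) \<in> stack n I" if "1 \<le> b"
    using that bounds[OF low[OF that]] closed(3)[OF low[OF that]]
    by (cases "b = 1") (simp_all add: mem_stack_iff)
qed

lemma order_ideals_mono:
  assumes "I \<in> J n"
  shows "I \<in> J (Suc n)"
  using assms P_mono[of n "Suc n"] by (auto simp: order_ideals_P_iff)

text \<open>Descending by blue steps preserves the coordinate sum and ends in the bottom
  row.\<close>

lemma corner_in_order_ideal:
  assumes I: "I \<in> J n" and "(a, b) \<in> I"
  shows "(a + b, 0) \<in> I"
proof -
  have "0 \<le> b" using assms by (rule order_ideal_bounds(2))
  then show ?thesis using assms(2)
  proof (induction b arbitrary: a rule: int_ge_induct)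
    case (step b)
    then have "(a + 1, b) \<in> I" using I by (force simp: order_ideals_P_iff)
    from step.IH[OF this] show ?case by (simp add: algebra_simps)
  qed simp
qed

lemma bottom_row_in_order_ideal:
  assumes I: "I \<in> J n" and "(c, 0) \<in> I" "0 \<le> a" "a \<le> c"
  shows "(a, 0) \<in> I"
  using assms(4,3)
proof (induction rule: int_le_induct)
  case (step i)
  then show ?case using I by (auto simp: order_ideals_P_iff)
qed (rule assms(2))

lemma order_ideal_without_corner:
  assumes I: "I \<in> J (Suc n)" and "(int n - 1, 0) \<notin> I"
  shows "I \<in> J n"
proof -
  have sub: "I \<subseteq> P (Suc n)" using I by (rule order_ideal_subset)
  have "(a, b) \<in> P n" if "(a, b) \<in> I" for a b
  proof -
    \<comment> \<open>\<open>P (Suc n)\<close> exceeds \<open>P n\<close> only by the antidiagonal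
      of sum n - 1, and any point of \<open>I\<close> on it would force the excluded corner into
      \<open>I\<close>.\<close>
    have "a + b \<noteq> int n - 1" using corner_in_order_ideal[OF I that] assms(2) by auto
    then show ?thesis using that sub by (force simp: P_def)
  qed
  with I show ?thesis by (auto simp: order_ideals_P_iff)
qed

lemma order_ideal_with_corner:
  assumes I: "I \<in> J (Suc n)" and corner: "(int n - 1, 0) \<in> I"
  shows "I \<in> stack n ` J n"
proof
  \<comment> \<open>The part of \<open>I\<close> above the bottom row, moved down by one; the guard
    discards the row itself, which would land at height -1.\<close>
  let ?K = "{(a, b). 0 \<le> b \<and> (a, b + 1) \<in> I}"
  have sub: "I \<subseteq> P (Suc n)" using I by (rule order_ideal_subset)
  show "?K \<in> J n"
    unfolding order_ideals_P_iff
  proof (intro conjI allI impI subrelI)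
    note bounds = order_ideal_bounds[OF I] and closed = order_ideal_closed[OF I]
    fix a b assume ab: "(a, b) \<in> ?K"
    then show "(a, b) \<in> P n"
      using bounds[of a "b + 1"] by (auto simp: P_def)
    show "(a - 1, b) \<in> ?K" if "1 \<le> a"
      using ab that closed(1)[of a "b + 1"] by simp
    show "(a, b - 1) \<in> ?K" "(a + 1, b - 1) \<in> ?K" if "1 \<le> b"
      using ab that closed(2,3)[of a "b + 1"] by simp_all
  qed
  show "I = stack n ?K"
  proof (intro set_eqI; clarify)
    fix a b
    \<comment> \<open>Red steps down from the corner fill the row, so both sets agree at height 0;
      above it they agree by the choice of \<open>?K\<close>.\<close>
    have "(a, 0) \<in> I" if "0 \<le> a" "a < int n"
      using bottom_row_in_order_ideal[OF I corner] that by simp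
    then show "(a, b) \<in> I \<longleftrightarrow> (a, b) \<in> stack n ?K"
      using sub by (auto simp: mem_stack_iff P_def)
  qed
qed

lemma order_ideals_P_Suc: "J (Suc n) = J n \<union> stack n ` J n"
  using order_ideals_mono stack_in_order_ideals order_ideal_without_corner order_ideal_with_corner
  by blast

(* Fails for n = 0: then both parts are {{}}. *)
lemma order_ideals_P_Suc_disjoint:
  assumes "n \<ge> 1"
  shows "J n \<inter> stack n ` J n = {}"
proof -
  have "(int n - 1, 0) \<in> stack n I" for I
    using assms by (simp add: mem_stack_iff)
  moreover have "(int n - 1, 0) \<notin> I" if "I \<in> J n" for I
    using order_ideal_bounds(3)[OF that] by fastforce
  ultimately show ?thesis by blast
qed

lemma rank_gf_P_Suc:
  assumes "n \<ge> 1"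
  shows "rank_gf (P (Suc n)) (P_le (Suc n)) = rank_gf (P n) (P_le n) * (1 + monom 1 n)"
proof -
  have "rank_gf (P (Suc n)) (P_le (Suc n)) =
      rank_gf (P n) (P_le n) + (\<Sum>I \<in> stack n ` J n. monom 1 (card I))"
    unfolding rank_gf_def order_ideals_P_Suc
    by (rule sum.union_disjoint) (simp_all add: finite_order_ideals order_ideals_P_Suc_disjoint[OF assms])
  also have "(\<Sum>I \<in> stack n ` J n. monom (1 :: int) (card I)) =
      (\<Sum>I \<in> J n. monom 1 (card (stack n I)))"
    by (rule sum.reindex_cong[OF inj_on_subset[OF inj_on_stack order_ideals_subset_Pow]]) auto
  also have "\<dots> = (\<Sum>I \<in> J n. monom 1 (card I) * monom 1 n)"
  proof (rule sum.cong)
    fix I assume "I \<in> J n"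
    then have "card (stack n I) = n + card I"
      using order_ideals_subset_Pow by (intro card_stack) auto
    then show "monom (1 :: int) (card (stack n I)) = monom 1 (card I) * monom 1 n"
      by (simp add: mult_monom add.commute)
  qed simp
  finally show ?thesis
    by (simp add: rank_gf_def sum_distrib_right distrib_left)
qed

lemma rank_gf_P:
  assumes "n \<ge> 1"
  shows "rank_gf (P n) (P_le n) = (\<Prod>j = 1..n - 1. 1 + monom 1 j)"
  using assms
\<comment> \<open>The induction starts at 1: \<open>P 0\<close> and \<open>P 1\<close> are both
  empty, while the recursion at n = 0 would claim a factor 1 + q^0 = 2.\<close>
proof (induction n rule: dec_induct)
  case base
  have "P 1 = {}" by (auto simp: P_def)
  then have "J 1 = {{}}" by (auto simp: order_ideals_def)
  then show ?case by (simp add: rank_gf_def)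
next
  case (step n)
  \<comment> \<open>This resolves the truncated \<open>n - 1\<close>, so that the factor for j = n
    splits off the product.\<close>
  then obtain m where "n = Suc m" by (cases n) auto
  with step show ?case by (simp add: rank_gf_P_Suc)
qed

text \<open>Every monomial takes the value 1 at q = 1. For an infinite family of ideals both sides
  are 0 by convention.\<close>

lemma poly_rank_gf_1: "poly (rank_gf A r) 1 = int (card (order_ideals A r))"
  by (simp add: rank_gf_def poly_sum poly_monom)

theorem theorem2p1:
  fixes n :: nat
  assumes "n \<ge> 1"
  shows "card (order_ideals (P n) (P_le n)) = 2 ^ (n - 1)
    \<and> rank_gf (P n) (P_le n) = (\<Prod>j = 1..n - 1. 1 + monom 1 j)"
proof -
  have "int (card (J n)) = (\<Prod>j = 1..n - 1. 2)"
    unfolding poly_rank_gf_1[symmetric] rank_gf_P[OF assms] by (simp add: poly_prod poly_monom)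
  also have "\<dots> = int (2 ^ (n - 1))" by simp
  finally show ?thesis using rank_gf_P[OF assms] by (simp only: of_nat_eq_iff)
qed

end
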